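(* Let $T\ge1$, $0\le P\le D(T-1)$ and $G_T\ge0$. For any causal online algorithm producing decisions in $\mathcal K$, there exists a sequence of convex functions $f_1,\dots,f_T:\mathcal K\to\mathbb R$ and subgradients $g_t\in\partial f_t(x_t)$ at the decisions $x_t$ of the algorithm, with $\sum_{t=1}^T\|g_t\|^2=G_T^2$, such that the worst-case dynamic regret of the algorithm on this sequence satisfies $$\max_{(x_t^* )_{t=1}^T\in\Omega_T^P}\;\sum_{t=1}^T\bigl(f_t(x_t)-f_t(x_t^* )\bigr)\;\ge\;\frac{D\,G_T}{2\sqrt2}\,\sqrt{\lfloor P/D\rfloor+1}.$$
   Context: $\mathcal K\subset\mathbb R^N$ is a nonempty convex, closed and bounded set with diameter $D=\sup_{x,v\in\mathcal K}\|x-v\|>0$; $\|\cdot\|$ is the Euclidean norm. For convex $f:\mathcal K\to\mathbb R$, $\partial f(x)$ is the set of $g\in\mathbb R^N$ with $f(x)-f(v)\le g^\top(x-v)$ for all $v\in\mathcal K$. A causal online algorithm chooses, at each round $t=1,\dots,T$, a decision $x_t\in\mathcal K$ as a function only of the information revealed in rounds $1,\dots,t-1$ (the functions $f_1,\dots,f_{t-1}$ and the received subgradients $g_1,\dots,g_{t-1}$); afterwards $f_t$ and $g_t$ are revealed. The comparator class is $$\Omega_T^P=\Bigl\{(x_t^* )_{t=1}^T:\ x_t^*\in\mathcal K,\ \sum_{t=1}^{T-1}\|x_{t+1}^*-x_t^*\|\le P\Bigr\}.$$ *)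

theory Defs
  imports "HOL-Analysis.Analysis"
begin

definition subdifferential :: "'a::real_inner set \<Rightarrow> ('a \<Rightarrow> real) \<Rightarrow> 'a \<Rightarrow> 'a set" where
  "subdifferential K f x = {g. \<forall>v\<in>K. f x - f v \<le> g \<bullet> (x - v)}"

type_synonym 'a history = "(('a \<Rightarrow> real) \<times> 'a) list"

(* Causality is built into the type: a decision is computed from the list of the pairs
   (f_1, g_1), ..., (f_(t-1), g_(t-1)) and nothing else.  Loss functions are functions on K;
   since HOL functions are total, the algorithm is shown only their restriction to K. *)
definition decision ::
    "'a set \<Rightarrow> ('a history \<Rightarrow> 'a) \<Rightarrow> (nat \<Rightarrow> 'a \<Rightarrow> real) \<Rightarrow> (nat \<Rightarrow> 'a) \<Rightarrow> nat \<Rightarrow> 'a" where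
  "decision K A f g t = A (map (\<lambda>s. (restrict (f s) K, g s)) [1..<t])"

definition admissible ::
    "'a::real_inner set \<Rightarrow> ('a history \<Rightarrow> 'a) \<Rightarrow> (nat \<Rightarrow> 'a \<Rightarrow> real) \<Rightarrow> (nat \<Rightarrow> 'a) \<Rightarrow> nat \<Rightarrow> bool" where
  "admissible K A f g n \<longleftrightarrow>
     (\<forall>t\<in>{1..n}. convex_on K (f t) \<and> g t \<in> subdifferential K (f t) (decision K A f g t))"

(* The decision of round t must lie in K whenever rounds 1, ..., t-1 were played according to
   the protocol; the value of A on lists that cannot arise in this way is irrelevant. *)
definition online_algorithm :: "'a::real_inner set \<Rightarrow> nat \<Rightarrow> ('a history \<Rightarrow> 'a) \<Rightarrow> bool" where
  "online_algorithm K T A \<longleftrightarrow>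
     (\<forall>f g. \<forall>t\<in>{1..T}. admissible K A f g (t - 1) \<longrightarrow> decision K A f g t \<in> K)"

(* Sequences are indexed by 1, ..., T; values at other indices are unconstrained and unused. *)
definition comparators :: "'a::real_normed_vector set \<Rightarrow> nat \<Rightarrow> real \<Rightarrow> (nat \<Rightarrow> 'a) set" where
  "comparators K T P =
     {y. (\<forall>t\<in>{1..T}. y t \<in> K) \<and> (\<Sum>t\<in>{1..<T}. norm (y (t + 1) - y t)) \<le> P}"

definition dynamic_regret ::
    "'a set \<Rightarrow> ('a history \<Rightarrow> 'a) \<Rightarrow> (nat \<Rightarrow> 'a \<Rightarrow> real) \<Rightarrow> (nat \<Rightarrow> 'a) \<Rightarrow> nat \<Rightarrow> (nat \<Rightarrow> 'a) \<Rightarrow> real" where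
  "dynamic_regret K A f g T y = (\<Sum>t=1..T. f t (decision K A f g t) - f t (y t))"

end

theory Submission
  imports Defs
begin

text \<open>Let \<open>a\<close> and \<open>b\<close> be points of \<open>K\<close> at distance \<open>D\<close>, let \<open>u\<close> be the unit vector from \<open>b\<close>
  to \<open>a\<close>, and let \<open>n = \<lfloor>P / D\<rfloor> + 1 \<le> T\<close>. In each of the first \<open>n\<close> rounds the adversary plays one of
  the linear losses with gradient \<open>\<plusminus>(G / sqrt n) u\<close>, the sign being that of
  \<open>u \<bullet> (x\<^sub>t - (a + b) / 2)\<close>; afterwards it plays \<open>0\<close>. By the choice of the sign, the better of
  \<open>a\<close> and \<open>b\<close> gains at least \<open>D G / (2 sqrt n)\<close> per round over the algorithm. A comparator that jumps
  between \<open>a\<close> and \<open>b\<close> at each of these rounds has path length at most \<open>(n - 1) D \<le> P\<close>, so the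
  regret is at least \<open>D G sqrt n / 2\<close>, which exceeds the claimed bound by a factor \<open>sqrt 2\<close>.\<close>

text \<open>Gradient and decision depend on each other, so the gradients are built by recursion on
  the round; it terminates because the history only reaches indices in \<open>[1..<t]\<close>. The
  response rule \<open>s\<close> sees the round and the current decision.\<close>

fun adversary ::
    "'a::real_inner set \<Rightarrow> ('a history \<Rightarrow> 'a) \<Rightarrow> (nat \<Rightarrow> 'a \<Rightarrow> 'a) \<Rightarrow> nat \<Rightarrow> 'a" where
  "adversary K A s t =
     s t (A (map (\<lambda>r. (restrict ((\<bullet>) (adversary K A s r)) K, adversary K A s r)) [1..<t]))"

declare adversary.simps [simp del]

lemma adversary_eq:
  "adversary K A s t = s t (decision K A (\<lambda>r. (\<bullet>) (adversary K A s r)) (adversary K A s) t)"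
  unfolding decision_def by (rule adversary.simps)

lemma admissible_linear:
  assumes "convex K"
  shows "admissible K A (\<lambda>t. (\<bullet>) (g t)) g n"
  using assms
  by (auto simp: admissible_def subdifferential_def inner_diff_right convex_on_def inner_right_distrib)

text \<open>Needed because the regret bound is claimed at a maximiser, not just at some comparator.
  By Tychonoff, sequences in \<open>K\<close> form a compact set in the product topology, where path
  length and objective are continuous.\<close>

lemma attains_max_comparators:
  fixes K :: "'a::real_normed_vector set" and h :: "nat \<Rightarrow> 'a \<Rightarrow> real"
  assumes "compact K" and "\<And>t. t \<in> {1..T} \<Longrightarrow> continuous_on UNIV (h t)"
    and "comparators K T P \<noteq> {}"
  shows "\<exists>y\<in>comparators K T P. \<forall>z\<in>comparators K T P. (\<Sum>t=1..T. h t (z t)) \<le> (\<Sum>t=1..T. h t (y t))"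
proof -
  define cut where "cut y = (\<lambda>t. if t \<in> {1..T} then y t else 0)" for y :: "nat \<Rightarrow> 'a"
  \<comment> \<open>Entries outside \<open>1, ..., T\<close> are free, so only the truncated comparators form a compact set.\<close>
  define B where "B = PiE UNIV (\<lambda>t. if t \<in> {1..T} then K else {0})"
  define C where "C = B \<inter> {y. (\<Sum>t\<in>{1..<T}. norm (y (t + 1) - y t)) \<le> P}"
  have "compact B"
    using assms(1)
    by (simp add: B_def compactin_PiE flip: compactin_euclidean_iff euclidean_product_topology)
  have cont: "continuous_on UNIV (\<lambda>y::nat \<Rightarrow> 'a. y t)" for t
    by (rule continuous_on_product_coordinates)
  have "closed {y::nat \<Rightarrow> 'a. (\<Sum>t\<in>{1..<T}. norm (y (t + 1) - y t)) \<le> P}"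
    by (intro closed_Collect_le continuous_intros cont)
  with \<open>compact B\<close> have "compact C"
    unfolding C_def by (rule compact_Int_closed)
  have CK: "C \<subseteq> comparators K T P"
    by (auto simp: C_def B_def comparators_def PiE_def Pi_def split: if_splits)
  have cutC: "cut y \<in> C" if "y \<in> comparators K T P" for y
    using that by (auto simp: C_def B_def comparators_def cut_def)
  have "C \<noteq> {}"
    using assms(3) cutC by blast
  moreover have "continuous_on C (\<lambda>y. \<Sum>t=1..T. h t (y t))"
    by (intro continuous_on_sum continuous_on_compose2[OF assms(2)] continuous_on_subset[OF cont]) auto
  ultimately obtain y where y: "y \<in> C" "\<And>z. z \<in> C \<Longrightarrow> (\<Sum>t=1..T. h t (z t)) \<le> (\<Sum>t=1..T. h t (y t))"
    using continuous_attains_sup[OF \<open>compact C\<close>] by blast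
  have "(\<Sum>t=1..T. h t (z t)) \<le> (\<Sum>t=1..T. h t (y t))" if "z \<in> comparators K T P" for z
    using y(2)[OF cutC[OF that]] by (simp add: cut_def)
  with y(1) CK show ?thesis by blast
qed

theorem theorem2:
  fixes K :: "(real ^ 'n) set"
    and A :: "(real ^ 'n) history \<Rightarrow> real ^ 'n"
    and T :: nat
    and P G :: real
  assumes "K \<noteq> {}" and "convex K" and "closed K" and "bounded K"
    and "diameter K > 0"
    and "T \<ge> 1"
    and "0 \<le> P" and "P \<le> diameter K * (real T - 1)"
    and "0 \<le> G"
    and "online_algorithm K T A"
  shows "\<exists>f g. admissible K A f g T \<and>
           (\<Sum>t=1..T. (norm (g t))\<^sup>2) = G\<^sup>2 \<and>
           (\<exists>y. is_arg_max (dynamic_regret K A f g T) (\<lambda>y. y \<in> comparators K T P) y \<and>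
                dynamic_regret K A f g T y
                  \<ge> diameter K * G / (2 * sqrt 2) * sqrt (of_int \<lfloor>P / diameter K\<rfloor> + 1))"
proof -
  define D where "D = diameter K"
  have D: "D > 0" using assms(5) by (simp add: D_def)
  have "compact K" using assms(3,4) by (simp add: compact_eq_bounded_closed)
  with assms(1) obtain a b where ab: "a \<in> K" "b \<in> K" "norm (a - b) = D"
    using diameter_compact_attained unfolding D_def by (metis dist_norm)
  define u where "u = (a - b) /\<^sub>R D"
  have u1: "norm u = 1" using ab D by (simp add: u_def)
  have "u \<bullet> (a - b) = D"
    using ab D by (simp add: u_def power2_eq_square flip: power2_norm_eq_inner)
  then have uD: "u \<bullet> a - u \<bullet> b = D"
    by (simp add: inner_diff_right)
  define n where "n = Suc (nat \<lfloor>P / D\<rfloor>)"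
  have fl: "0 \<le> P / D" using D assms(7) by simp
  have rn: "real n = of_int \<lfloor>P / D\<rfloor> + 1" using fl by (simp add: n_def)
  have "(real n - 1) * D \<le> P"
    using rn D by (simp add: field_simps) (metis floor_divide_lower mult.commute)
  have "P / D \<le> real T - 1" using assms(8) D by (simp add: D_def field_simps)
  then have "real n \<le> real T" using rn by linarith
  then have nT: "n \<le> T" by simp
  \<comment> \<open>Chosen so that \<open>n\<close> gradients of norm \<open>c\<close> have squared
    norms adding up to \<open>G\<^sup>2\<close>.\<close>
  define c where "c = G / sqrt (real n)"
  have n0: "n > 0" by (simp add: n_def)
  have c0: "c \<ge> 0" using assms(9) by (simp add: c_def)
  define s where "s t x = (if t \<le> n then (if u \<bullet> x \<ge> (u \<bullet> a + u \<bullet> b) / 2 then c *\<^sub>R u else - (c *\<^sub>R u)) else 0)"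
    for t x
  define g where "g = adversary K A s"
  define f where "f = (\<lambda>t. (\<bullet>) (g t))"
  define x where "x = decision K A f g"
  \<comment> \<open>For \<open>t \<le> n\<close> this endpoint minimises the loss over
    \<open>a\<close> and \<open>b\<close>, so the test repeats that of \<open>s\<close>, ties
    included.\<close>
  define z where "z t = (if u \<bullet> x t \<ge> (u \<bullet> a + u \<bullet> b) / 2 then b else a)" for t
  have gs: "g t = s t (x t)" for t
    unfolding g_def f_def x_def by (rule adversary_eq)
  have adm: "admissible K A f g T"
    unfolding f_def by (rule admissible_linear[OF assms(2)])
  have sum_n: "(\<Sum>t=1..T. if t \<le> n then r else 0) = real n * r" for r :: real
  proof -
    have "(\<Sum>t=1..T. if t \<le> n then r else 0) = (\<Sum>t=1..n. r)"
      using nT by (intro sum.mono_neutral_cong_right) auto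
    then show ?thesis by simp
  qed
  have "(\<Sum>t=1..T. (norm (g t))\<^sup>2) = (\<Sum>t=1..T. if t \<le> n then c\<^sup>2 else 0)"
    by (intro sum.cong) (auto simp: gs s_def u1)
  also have "\<dots> = G\<^sup>2"
    unfolding sum_n using n0 by (simp add: c_def power_divide)
  finally have norm_g: "(\<Sum>t=1..T. (norm (g t))\<^sup>2) = G\<^sup>2" .

  \<comment> \<open>Freezing after round \<open>n\<close> caps the number of jumps at
    \<open>n - 1\<close>; the later losses vanish, so this costs nothing.\<close>
  define y where "y t = z (min t n)" for t
  have zK: "z t \<in> K" for t using ab by (simp add: z_def)
  have zz: "norm (z i - z j) \<le> D" for i j
    using ab D by (auto simp: z_def norm_minus_commute)
  have "(\<Sum>t\<in>{1..<T}. norm (y (t + 1) - y t)) = (\<Sum>t\<in>{1..<n}. norm (y (t + 1) - y t))"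
    using nT by (intro sum.mono_neutral_cong_right) (auto simp: y_def)
  also have "\<dots> \<le> (\<Sum>t\<in>{1..<n}. D)"
    by (intro sum_mono) (simp add: y_def zz)
  also have "\<dots> \<le> P"
    using \<open>(real n - 1) * D \<le> P\<close> n0 by (simp add: of_nat_diff)
  finally have yC: "y \<in> comparators K T P"
    using zK by (simp add: comparators_def y_def)

  have "real n * (c * D / 2) = (\<Sum>t=1..T. if t \<le> n then c * D / 2 else 0)"
    by (rule sum_n[symmetric])
  also have "\<dots> \<le> (\<Sum>t=1..T. f t (x t) - f t (y t))"
  proof (intro sum_mono)
    fix t
    \<comment> \<open>The threshold is the midpoint value, so \<open>u \<bullet> x t\<close> is at
      least \<open>D / 2\<close> away from the value at the chosen endpoint.\<close>
    have "c * (D / 2) \<le> c * (u \<bullet> x t - u \<bullet> b)" if "u \<bullet> x t \<ge> (u \<bullet> a + u \<bullet> b) / 2"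
      using that uD c0 by (intro mult_left_mono) (auto simp: field_simps)
    moreover have "c * (D / 2) \<le> c * (u \<bullet> a - u \<bullet> x t)" if "\<not> u \<bullet> x t \<ge> (u \<bullet> a + u \<bullet> b) / 2"
      using that uD c0 by (intro mult_left_mono) (auto simp: field_simps)
    ultimately show "(if t \<le> n then c * D / 2 else 0) \<le> f t (x t) - f t (y t)"
      by (auto simp: f_def gs s_def y_def z_def min_def algebra_simps)
  qed
  finally have "real n * (c * D / 2) \<le> dynamic_regret K A f g T y"
    by (simp add: dynamic_regret_def x_def)
  moreover have "D * G / (2 * sqrt 2) * sqrt (real n) \<le> real n * (c * D / 2)"
  proof -
    have "real n * c = G * sqrt (real n)"
      using n0 by (simp add: c_def real_div_sqrt field_simps)
    moreover have "D * G * sqrt (real n) / (2 * sqrt 2) \<le> D * G * sqrt (real n) / 2"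
      using D assms(9) by (intro divide_left_mono) auto
    ultimately show ?thesis by (simp add: mult_ac)
  qed
  ultimately have low: "D * G / (2 * sqrt 2) * sqrt (of_int \<lfloor>P / D\<rfloor> + 1) \<le> dynamic_regret K A f g T y"
    using rn by simp

  \<comment> \<open>The explicit \<open>y\<close> only bounds the maximum from below; a maximiser
    \<open>w\<close> does at least as well.\<close>
  have "continuous_on UNIV (\<lambda>v. f t (x t) - f t v)" for t
    unfolding f_def by (intro continuous_intros)
  then have "\<exists>w\<in>comparators K T P. \<forall>v\<in>comparators K T P.
      (\<Sum>t=1..T. f t (x t) - f t (v t)) \<le> (\<Sum>t=1..T. f t (x t) - f t (w t))"
    using yC by (intro attains_max_comparators \<open>compact K\<close>) auto
  then obtain w where w: "w \<in> comparators K T P"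
    and max: "\<And>v. v \<in> comparators K T P \<Longrightarrow> dynamic_regret K A f g T v \<le> dynamic_regret K A f g T w"
    unfolding dynamic_regret_def x_def by blast
  then have "is_arg_max (dynamic_regret K A f g T) (\<lambda>y. y \<in> comparators K T P) w"
    by (simp add: is_arg_max_linorder)
  with adm norm_g low max[OF yC] show ?thesis
    unfolding D_def by (blast intro: order_trans)
qed

end
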